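(* Let $n$ be a positive integer and let $A=(a_{ij})_{0\le i\le 2n,\,0\le j\le n}$ be a real $(2n+1)\times(n+1)$ matrix with non-zero entries. Then the following two hold: (1) Suppose that the rank of $A$ is $n+1$. Then there exists a closed subset $\Sigma_A\subset(\mathbb{R}^{n+1})^{2n+1}$ with Lebesgue measure zero such that for any $p=(p_0,p_1,\ldots,p_{2n})\in(\mathbb{R}^{n+1})^{2n+1}-\Sigma_A$, the mapping $G_{(p,A)}:\mathbb{R}^{n+1}\to\mathbb{R}^{2n+1}$ is $\mathcal{A}$-equivalent to the mapping $\mathbb{R}^{n+1}\to\mathbb{R}^{2n+1}$ \[ (x_0,x_1,\ldots,x_n)\mapsto(x_0^2,\,x_0x_1,\ldots,x_0x_n,\,x_1,\ldots,x_n). \] (2) Suppose that the rank of $A$ is less than $n+1$. Then there exists a closed subset $\Sigma_A\subset(\mathbb{R}^{n+1})^{2n+1}$ with Lebesgue measure zero such that for any $p=(p_0,p_1,\ldots,p_{2n})\in(\mathbb{R}^{n+1})^{2n+1}-\Sigma_A$, the mapping $G_{(p,A)}$ is $\mathcal{A}$-equivalent to the inclusion $\mathbb{R}^{n+1}\to\mathbb{R}^{2n+1}$, $(x_0,x_1,\ldots,x_n)\mapsto(x_0,x_1,\ldots,x_n,0,\ldots,0)$.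
   Context: For positive integers $k,n$, points $p_i=(p_{i0},p_{i1},\ldots,p_{in})\in\mathbb{R}^{n+1}$ $(0\le i\le k)$, and a real $(k+1)\times(n+1)$ matrix $A=(a_{ij})_{0\le i\le k,\,0\le j\le n}$ with all entries non-zero, write $p=(p_0,\ldots,p_k)\in(\mathbb{R}^{n+1})^{k+1}$. The generalized distance-squared mapping $G_{(p,A)}=G_{(p_0,p_1,\ldots,p_k,A)}:\mathbb{R}^{n+1}\to\mathbb{R}^{k+1}$ is defined by \[ G_{(p,A)}(x)=\left(\sum_{j=0}^n a_{0j}(x_j-p_{0j})^2,\ \sum_{j=0}^n a_{1j}(x_j-p_{1j})^2,\ \ldots,\ \sum_{j=0}^n a_{kj}(x_j-p_{kj})^2\right),\quad x=(x_0,\ldots,x_n)\in\mathbb{R}^{n+1}. \] Here $k=2n$. Two mappings $f_1,f_2:\mathbb{R}^{n+1}\to\mathbb{R}^{k+1}$ are $\mathcal{A}$-equivalent if there exist $C^\infty$ diffeomorphisms $h:\mathbb{R}^{n+1}\to\mathbb{R}^{n+1}$ and $H:\mathbb{R}^{k+1}\to\mathbb{R}^{k+1}$ such that $f_1=H\circ f_2\circ h$. *)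

theory Defs
  imports "HOL-Analysis.Analysis"
begin

text \<open>
  For a finite index type \<open>'n\<close> with \<open>CARD('n) = n \<ge> 1\<close>, the space $\mathbf{R}^{n+1}$ is
  \<open>real ^ 'n option\<close>, where \<open>None\<close> is the index $0$ and \<open>Some j\<close> ranges over the indices
  $1, \ldots, n$.  The space $\mathbf{R}^{2n+1}$ is \<open>real ^ ('n + 'n) option\<close>, where \<open>None\<close> is
  the index $0$, \<open>Some (Inl j)\<close> ranges over $1, \ldots, n$ and \<open>Some (Inr j)\<close> over
  $n+1, \ldots, 2n$.
\<close>

text \<open>
  In finite dimensions, \<open>f\<close> is of class $C^{k+1}$ iff it is differentiable and each directional
  derivative is of class $C^k$.
\<close>

primrec Ck :: "nat \<Rightarrow> ('a::euclidean_space \<Rightarrow> 'b::euclidean_space) \<Rightarrow> bool" where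
  "Ck 0 f \<longleftrightarrow> continuous_on UNIV f"
| "Ck (Suc k) f \<longleftrightarrow>
     (\<forall>x. f differentiable (at x)) \<and> (\<forall>v. Ck k (\<lambda>x. frechet_derivative f (at x) v))"

definition smooth :: "('a::euclidean_space \<Rightarrow> 'b::euclidean_space) \<Rightarrow> bool" where
  "smooth f \<longleftrightarrow> (\<forall>k. Ck k f)"

definition diffeomorphism :: "('a::euclidean_space \<Rightarrow> 'b::euclidean_space) \<Rightarrow> bool" where
  "diffeomorphism h \<longleftrightarrow> bij h \<and> smooth h \<and> smooth (inv h)"

definition A_equivalent ::
  "('a::euclidean_space \<Rightarrow> 'b::euclidean_space) \<Rightarrow> ('a \<Rightarrow> 'b) \<Rightarrow> bool" where
  "A_equivalent f1 f2 \<longleftrightarrow>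
     (\<exists>h H. diffeomorphism h \<and> diffeomorphism H \<and> f1 = H \<circ> f2 \<circ> h)"

definition dist_sq_map ::
  "real ^ 'm ^ 'k \<Rightarrow> real ^ 'm ^ 'k \<Rightarrow> real ^ 'm \<Rightarrow> real ^ 'k" where
  "dist_sq_map p A x = (\<chi> i. \<Sum>j\<in>UNIV. A $ i $ j * (x $ j - p $ i $ j)\<^sup>2)"

definition whitney_umbrella :: "real ^ 'n::finite option \<Rightarrow> real ^ ('n + 'n) option" where
  "whitney_umbrella x = (\<chi> i. case i of
       None \<Rightarrow> (x $ None)\<^sup>2
     | Some (Inl j) \<Rightarrow> x $ None * x $ Some j
     | Some (Inr j) \<Rightarrow> x $ Some j)"

definition std_inclusion :: "real ^ 'n::finite option \<Rightarrow> real ^ ('n + 'n) option" where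
  "std_inclusion x = (\<chi> i. case i of
       None \<Rightarrow> x $ None
     | Some (Inl j) \<Rightarrow> x $ Some j
     | Some (Inr j) \<Rightarrow> 0)"

end

theory Submission
  imports Defs
begin

text \<open>
  Up to a translation of the target, the mapping is \<open>x \<mapsto> A u - 2 B x\<close> with \<open>u\<^sub>j = x\<^sub>j\<^sup>2\<close> and
  \<open>B\<^sub>i\<^sub>j = a\<^sub>i\<^sub>j p\<^sub>i\<^sub>j\<close>; as no \<open>a\<^sub>i\<^sub>j\<close> vanishes, \<open>B\<close> is an arbitrary matrix. Linear forms that annihilate
  the range of \<open>A\<close> turn the mapping into a linear one. If \<open>rank A \<le> n\<close>, there are \<open>n + 1\<close> such
  independent forms, for generic \<open>B\<close> they give source coordinates, and the other components are
  polynomials in them, which a shear of the target removes. If \<open>rank A = n + 1\<close>, there are only \<open>n\<close>,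
  giving an \<open>n \<times> (n + 1)\<close> matrix \<open>M\<close>; for generic \<open>B\<close> its kernel is spanned by a vector \<open>v\<close> with all
  coordinates non-zero. The forms \<open>x\<^sub>j - v\<^sub>j x\<^sub>0\<close> are then functions of the target, and completing
  squares in the other components leaves \<open>s\<^sup>2\<close> and \<open>s z\<^sub>j\<close>, with \<open>z\<^sub>j\<close> a multiple of the \<open>j\<close>-th form plus a constant.
  In both cases the exceptional \<open>p\<close> are zeros of determinants that are non-trivial polynomials in \<open>p\<close>.
\<close>

subsection \<open>Polynomial automorphisms\<close>

lemma real_polynomial_function_has_derivative:
  fixes f :: "'a::euclidean_space \<Rightarrow> real"
  assumes "real_polynomial_function f"
  shows "\<exists>D. (\<forall>x. (f has_derivative D x) (at x)) \<and> (\<forall>v. real_polynomial_function (\<lambda>x. D x v))"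
  using assms
proof induction
  case (linear f)
  then show ?case
    by (intro exI[of _ "\<lambda>_. f"]) (auto intro: bounded_linear_imp_has_derivative)
next
  case (const c)
  show ?case
    by (intro exI[of _ "\<lambda>_ _. 0"]) auto
next
  case (add f g)
  then obtain D E where "\<And>x. (f has_derivative D x) (at x)" "\<And>v. real_polynomial_function (\<lambda>x. D x v)"
    "\<And>x. (g has_derivative E x) (at x)" "\<And>v. real_polynomial_function (\<lambda>x. E x v)"
    by metis
  then show ?case
    by (intro exI[of _ "\<lambda>x v. D x v + E x v"]) (auto intro: has_derivative_add)
next
  case (mult f g)
  then obtain D E where "\<And>x. (f has_derivative D x) (at x)" "\<And>v. real_polynomial_function (\<lambda>x. D x v)"
    "\<And>x. (g has_derivative E x) (at x)" "\<And>v. real_polynomial_function (\<lambda>x. E x v)"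
    by metis
  with mult.hyps show ?case
    by (intro exI[of _ "\<lambda>x v. f x * E x v + D x v * g x"])
      (auto intro: has_derivative_mult intro!: real_polynomial_function.intros(3,4))
qed

text \<open>For each fixed direction the derivative is again polynomial in the base point. This
  matches the recursion in \<open>Ck\<close>, so an induction on the order can pass to directional
  derivatives.\<close>

lemma polynomial_function_has_derivative:
  fixes f :: "'a::euclidean_space \<Rightarrow> 'b::euclidean_space"
  assumes "polynomial_function f"
  shows "\<exists>D. (\<forall>x. (f has_derivative D x) (at x)) \<and> (\<forall>v. polynomial_function (\<lambda>x. D x v))"
proof -
  have "\<forall>b\<in>Basis. \<exists>D. (\<forall>x. ((\<lambda>x. f x \<bullet> b) has_derivative D x) (at x)) \<and>
      (\<forall>v. real_polynomial_function (\<lambda>x. D x v))"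
    using assms by (auto simp: polynomial_function_iff_Basis_inner intro: real_polynomial_function_has_derivative)
  then obtain D where D: "\<And>b x. b \<in> Basis \<Longrightarrow> ((\<lambda>x. f x \<bullet> b) has_derivative D b x) (at x)"
    "\<And>b v. b \<in> Basis \<Longrightarrow> real_polynomial_function (\<lambda>x. D b x v)"
    by metis
  define E where "E x v = (\<Sum>b\<in>Basis. D b x v *\<^sub>R b)" for x v
  have E: "E x v \<bullet> b = D b x v" if "b \<in> Basis" for x v b
    using that by (simp add: E_def)
  have "(f has_derivative E x) (at x)" for x
    unfolding has_derivative_componentwise_within[of f] by (auto simp: E D)
  moreover have "polynomial_function (\<lambda>x. E x v)" for v
    by (auto simp: polynomial_function_iff_Basis_inner E D)
  ultimately show ?thesis
    by blast
qed

lemma Ck_polynomial_function: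
  fixes f :: "'a::euclidean_space \<Rightarrow> 'b::euclidean_space"
  assumes "polynomial_function f"
  shows "Ck k f"
  using assms
proof (induction k arbitrary: f)
  case 0
  then show ?case
    by (simp add: continuous_on_polymonial_function)
next
  case (Suc k)
  obtain D where D: "\<And>x. (f has_derivative D x) (at x)" "\<And>v. polynomial_function (\<lambda>x. D x v)"
    using polynomial_function_has_derivative[OF Suc.prems] by metis
  have "frechet_derivative f (at x) = D x" for x
    using D(1) by (rule frechet_derivative_at[symmetric])
  with D Suc.IH show ?case
    by (auto simp: differentiable_def)
qed

lemma smooth_polynomial_function:
  fixes f :: "'a::euclidean_space \<Rightarrow> 'b::euclidean_space"
  shows "polynomial_function f \<Longrightarrow> smooth f"
  by (simp add: smooth_def Ck_polynomial_function)

lemma diffeomorphism_polynomial: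
  fixes f :: "'a::euclidean_space \<Rightarrow> 'b::euclidean_space"
  assumes "polynomial_function f" "polynomial_function g" "\<And>x. g (f x) = x" "\<And>y. f (g y) = y"
  shows "diffeomorphism f"
proof -
  have "inv f = g"
    using assms(3,4) by (intro inv_unique_comp) auto
  moreover have "bij f"
    using assms(3,4) by (metis bijI')
  ultimately show ?thesis
    using assms(1,2) by (simp add: diffeomorphism_def smooth_polynomial_function)
qed

lemma polynomial_function_linear:
  fixes f :: "'a::euclidean_space \<Rightarrow> 'b::euclidean_space"
  shows "linear f \<Longrightarrow> polynomial_function f"
  by (simp add: linear_conv_bounded_linear polynomial_function_bounded_linear)

lemma polynomial_function_linear_compose:
  fixes f :: "'a::euclidean_space \<Rightarrow> 'b::euclidean_space"
  shows "linear f \<Longrightarrow> polynomial_function g \<Longrightarrow> polynomial_function (\<lambda>x. f (g x))"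
  using polynomial_function_compose[of g f] by (simp add: o_def polynomial_function_linear)

lemma polynomial_function_matrix_vector:
  fixes A :: "real ^ 'n ^ 'm"
  shows "polynomial_function f \<Longrightarrow> polynomial_function (\<lambda>x. A *v f x)"
  by (rule polynomial_function_linear_compose) simp_all

lemma polynomial_function_vec:
  fixes f :: "'a::real_normed_vector \<Rightarrow> real ^ 'n"
  assumes "\<And>i. real_polynomial_function (\<lambda>x. f x $ i)"
  shows "polynomial_function f"
  using assms by (auto simp: polynomial_function_iff_Basis_inner Basis_vec_def inner_axis)

lemma polynomial_function_nth:
  fixes f :: "'a::real_normed_vector \<Rightarrow> 'b::real_normed_vector ^ 'n"
  assumes "polynomial_function f"
  shows "polynomial_function (\<lambda>x. f x $ i)"
proof -
  have "polynomial_function ((\<lambda>y. y $ i) \<circ> f)"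
    by (intro polynomial_function_compose assms polynomial_function_bounded_linear bounded_linear_vec_nth)
  then show ?thesis
    by (simp add: o_def)
qed

text \<open>The two identities for \<open>\<phi>\<close> make \<open>y \<mapsto> y + \<phi> y\<close> invertible, with inverse \<open>y \<mapsto> y - \<phi> y\<close>.\<close>

lemma A_equivalent_affine_shear:
  fixes f1 f2 :: "'a::euclidean_space \<Rightarrow> 'b::euclidean_space"
  assumes D: "linear D" "inj D" and L: "linear L" "inj L"
    and \<phi>: "polynomial_function \<phi>" "\<And>y. \<phi> (y + \<phi> y) = \<phi> y" "\<And>y. \<phi> (y - \<phi> y) = \<phi> y"
    and eq: "\<And>x. f1 x = L (f2 (D x + d) + \<phi> (f2 (D x + d))) + c"
  shows "A_equivalent f1 f2"
proof -
  obtain D' where D': "linear D'" "\<And>x. D' (D x) = x" "\<And>x. D (D' x) = x"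
    using linear_injective_isomorphism[OF D] by auto
  obtain L' where L': "linear L'" "\<And>x. L' (L x) = x" "\<And>x. L (L' x) = x"
    using linear_injective_isomorphism[OF L] by auto
  define H' where "H' y = L' (y - c) - \<phi> (L' (y - c))" for y
  have "polynomial_function (\<lambda>x. D x + d)"
    by (intro polynomial_function_add polynomial_function_linear D polynomial_function_const)
  moreover have "polynomial_function (\<lambda>y. D' (y - d))"
    by (intro polynomial_function_linear_compose[OF D'(1)] polynomial_function_diff polynomial_function_const polynomial_function_id)
  ultimately have "diffeomorphism (\<lambda>x. D x + d)"
    by (rule diffeomorphism_polynomial) (simp_all add: D')
  moreover have "diffeomorphism (\<lambda>y. L (y + \<phi> y) + c)"
  proof (rule diffeomorphism_polynomial[where g = H'])
    have "polynomial_function (\<lambda>y. L' (y - c))"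
      by (intro polynomial_function_linear_compose[OF L'(1)]) auto
    moreover from this have "polynomial_function (\<lambda>y. \<phi> (L' (y - c)))"
      using polynomial_function_compose[OF _ \<phi>(1)] by (simp add: o_def)
    ultimately show "polynomial_function H'"
      unfolding H'_def by (rule polynomial_function_diff)
    show "polynomial_function (\<lambda>y. L (y + \<phi> y) + c)"
      by (intro polynomial_function_add polynomial_function_linear_compose[OF L(1)] \<phi>(1)
          polynomial_function_id polynomial_function_const)
  qed (simp_all add: H'_def L' \<phi>)
  ultimately show ?thesis
    unfolding A_equivalent_def using eq
    by (intro exI[of _ "\<lambda>x. D x + d"] exI[of _ "\<lambda>y. L (y + \<phi> y) + c"]) auto
qed

subsection \<open>Zero sets of polynomials\<close>

lemma finite_zeros_real_polynomial_function:
  fixes g :: "real \<Rightarrow> real"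
  assumes "real_polynomial_function g" "g t \<noteq> 0"
  shows "finite {s. g s = 0}"
proof -
  obtain a n where g: "g = (\<lambda>x. \<Sum>i\<le>n. a i * x ^ i)"
    using assms(1) by (auto simp: real_polynomial_function_iff_sum)
  with assms(2) have "\<exists>i\<le>n. a i \<noteq> 0"
    by (metis (no_types, lifting) atMost_iff mult_eq_0_iff sum.neutral)
  then show ?thesis
    by (simp add: g polyfun_finite_roots)
qed

text \<open>
  By Fubini: each ray from \<open>0\<close> meets the zero set in finitely many points, so almost every rescaling of
  the zero set is a null set.
\<close>

lemma negligible_zeros_real_polynomial_function_0:
  fixes f :: "'a::euclidean_space \<Rightarrow> real"
  assumes f: "real_polynomial_function f" and "f 0 \<noteq> 0"
  shows "negligible {x. f x = 0}"
proof -
  have cont: "continuous_on UNIV f"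
    using f by (simp add: continuous_on_polymonial_function real_polynomial_function_eq)
  \<comment> \<open>At \<open>s = 0\<close> the value is \<open>f 0\<close>, so no restriction of
    \<open>f\<close> to a line through the origin vanishes identically.\<close>
  have AE_ray: "AE s in lborel. f (s *\<^sub>R x) \<noteq> 0" for x
  proof -
    have "real_polynomial_function (f \<circ> (\<lambda>s. s *\<^sub>R x))"
      by (intro real_polynomial_function_compose f polynomial_function_bounded_linear bounded_linear_scaleR_left)
    then have "finite {s. f (s *\<^sub>R x) = 0}"
      using finite_zeros_real_polynomial_function[of "\<lambda>s. f (s *\<^sub>R x)" 0] \<open>f 0 \<noteq> 0\<close> by (simp add: o_def)
    then have "{s. f (s *\<^sub>R x) = 0} \<in> null_sets lborel"
      by (rule finite_imp_null_set_lborel)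
    then show ?thesis
      by (rule AE_I') auto
  qed
  have "continuous_on UNIV (\<lambda>z. f (snd z *\<^sub>R fst z))"
    by (rule continuous_on_compose2[OF cont]) (auto intro!: continuous_intros)
  then have "{z :: 'a \<times> real. f (snd z *\<^sub>R fst z) \<noteq> 0} \<in> sets (borel :: ('a \<times> real) measure)"
    by (intro borel_open open_Collect_neq) (auto intro!: continuous_intros)
  moreover have "sets (lborel \<Otimes>\<^sub>M lborel :: ('a \<times> real) measure) = sets borel"
    by (simp only: lborel_prod sets_lborel)
  ultimately have "{z \<in> space (lborel \<Otimes>\<^sub>M lborel). f (snd z *\<^sub>R fst z) \<noteq> 0}
      \<in> sets (lborel \<Otimes>\<^sub>M lborel :: ('a \<times> real) measure)"
    by (simp only: space_pair_measure space_lborel) simp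
  then have "AE s in lborel. AE x in lborel. f (s *\<^sub>R x) \<noteq> 0"
    by (subst lborel_pair.AE_commute[symmetric]) (simp_all add: AE_ray)
  \<comment> \<open>One good scale is enough, but it must be non-zero so that the rescaling can be
    undone.\<close>
  moreover have "AE s in lborel. s \<noteq> (0::real)"
    by (rule AE_lborel_singleton)
  ultimately have "AE s in lborel. s \<noteq> 0 \<and> (AE x in lborel. f (s *\<^sub>R x) \<noteq> 0)"
    by eventually_elim simp
  then have "\<exists>s. s \<noteq> (0::real) \<and> (AE x in lborel. f (s *\<^sub>R x) \<noteq> 0)"
    using eventually_happens'[of "ae_filter (lborel :: real measure)"] by (simp add: ae_filter_eq_bot_iff)
  then obtain s where s: "s \<noteq> (0::real)" "AE x in lborel. f (s *\<^sub>R x) \<noteq> 0"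
    by blast
  have "closed {x. f (s *\<^sub>R x) = 0}"
    by (intro closed_Collect_eq continuous_on_compose2[OF cont]) (auto intro!: continuous_intros)
  then have "{x. f (s *\<^sub>R x) = 0} \<in> null_sets lborel"
    using s(2) by (subst AE_iff_null_sets) (simp_all add: borel_closed)
  then have "{x. f (s *\<^sub>R x) = 0} \<in> null_sets lebesgue"
    by (rule null_sets_completionI)
  then have "negligible ((\<lambda>x. s *\<^sub>R x) ` {x. f (s *\<^sub>R x) = 0})"
    by (intro negligible_differentiable_image_negligible order_refl linear_imp_differentiable_on linear_scale_self)
      (simp add: negligible_iff_null_sets)
  moreover have "{x. f x = 0} \<subseteq> (\<lambda>x. s *\<^sub>R x) ` {x. f (s *\<^sub>R x) = 0}"
  proof
    fix x
    assume "x \<in> {x. f x = 0}"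
    with s(1) show "x \<in> (\<lambda>x. s *\<^sub>R x) ` {x. f (s *\<^sub>R x) = 0}"
      by (intro image_eqI[where x = "inverse s *\<^sub>R x"]) auto
  qed
  ultimately show ?thesis
    by (rule negligible_subset)
qed

lemma negligible_zeros_real_polynomial_function:
  fixes f :: "'a::euclidean_space \<Rightarrow> real"
  assumes f: "real_polynomial_function f" and "f q \<noteq> 0"
  shows "negligible {x. f x = 0}"
proof -
  have "real_polynomial_function (f \<circ> (\<lambda>x. q + x))"
    by (intro real_polynomial_function_compose f polynomial_function_add polynomial_function_const polynomial_function_id)
  then have "negligible {x. f (q + x) = 0}"
    using \<open>f q \<noteq> 0\<close> negligible_zeros_real_polynomial_function_0[of "\<lambda>x. f (q + x)"] by (simp add: o_def)
  then have "negligible ((+) q ` {x. f (q + x) = 0})"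
    by (rule negligible_translation)
  moreover have "(+) q ` {x. f (q + x) = 0} = {x. f x = 0}"
  proof (intro set_eqI iffI)
    fix x
    assume "x \<in> {x. f x = 0}"
    then show "x \<in> (+) q ` {x. f (q + x) = 0}"
      by (intro image_eqI[where x = "x - q"]) auto
  qed auto
  ultimately show ?thesis
    by simp
qed

lemma real_polynomial_function_det:
  fixes F :: "'a::real_normed_vector \<Rightarrow> real ^ 'n ^ 'n"
  assumes "\<And>i j. real_polynomial_function (\<lambda>x. F x $ i $ j)"
  shows "real_polynomial_function (\<lambda>x. det (F x))"
  unfolding det_def
  by (intro real_polynomial_function_sum real_polynomial_function.intros(2,4)
      real_polynomial_function_prod assms finite_permutations finite)

text \<open>Reduces each genericity claim to exhibiting a single \<open>q\<close> with non-zero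
  determinant.\<close>

lemma closed_null_zeros_det:
  fixes F :: "'a::euclidean_space \<Rightarrow> real ^ 'n ^ 'n"
  assumes "\<And>i j. real_polynomial_function (\<lambda>x. F x $ i $ j)" "det (F q) \<noteq> 0"
  shows "closed {x. det (F x) = 0}" "{x. det (F x) = 0} \<in> null_sets lebesgue"
proof -
  have F: "real_polynomial_function (\<lambda>x. det (F x))"
    by (intro real_polynomial_function_det assms)
  then have "continuous_on UNIV (\<lambda>x. det (F x))"
    by (simp add: continuous_on_polymonial_function real_polynomial_function_eq)
  then show "closed {x. det (F x) = 0}"
    by (intro closed_Collect_eq) auto
  show "{x. det (F x) = 0} \<in> null_sets lebesgue"
    using negligible_zeros_real_polynomial_function[OF F assms(2)] by (simp add: negligible_iff_null_sets)
qed

subsection \<open>Linear algebra\<close>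

text \<open>The orthogonal complement of the range of \<open>A\<close> has dimension at least
  \<open>card I\<close>. The rows indexed by \<open>I\<close> come from an orthonormal basis of it;
  the other rows complete them to an orthonormal basis of the whole space.\<close>

lemma exists_orthogonal_annihilator:
  fixes A :: "real ^ 'm ^ 'k" and I :: "'k set"
  assumes "rank A + card I \<le> CARD('k)"
  obtains U :: "real ^ 'k ^ 'k" where "orthogonal_matrix U" "\<And>i x. i \<in> I \<Longrightarrow> (U *v (A *v x)) $ i = 0"
proof -
  define V where "V = range (\<lambda>x. A *v x)"
  have V: "subspace V"
    unfolding V_def by (rule linear_subspace_image) auto
  define W where "W = {y. \<forall>x\<in>V. orthogonal x y}"
  have W: "subspace W"
    unfolding W_def by (rule subspace_orthogonal_to_vectors)
  have dimW: "dim W + dim V = CARD('k)"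
    using dim_subspace_orthogonal_to_vectors[OF V subspace_UNIV] by (simp add: W_def)
  obtain B where B: "B \<subseteq> V" "pairwise orthogonal B" "\<And>x. x \<in> B \<Longrightarrow> norm x = 1" "independent B" "card B = dim V"
    using orthonormal_basis_subspace[OF V] by metis
  obtain C where C: "C \<subseteq> W" "pairwise orthogonal C" "\<And>x. x \<in> C \<Longrightarrow> norm x = 1" "independent C" "card C = dim W"
    using orthonormal_basis_subspace[OF W] by metis
  have BC: "orthogonal x y" if "x \<in> B" "y \<in> C" for x y
    using that B(1) C(1) by (auto simp: W_def)
  have fin: "finite B" "finite C"
    using B(4) C(4) independent_imp_finite by auto
  have "B \<inter> C = {}"
    using BC B(3) by (force simp: orthogonal_def)
  then have card: "card (B \<union> C) = CARD('k)"
    using fin B(5) C(5) dimW by (simp add: card_Un_disjoint)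
  have "card I \<le> card C"
    using assms dimW C(5) by (simp add: V_def rank_dim_range)
  then obtain e1 where e1: "inj_on e1 I" "e1 ` I \<subseteq> C"
    using card_le_inj[of I C] fin by auto
  \<comment> \<open>As many basis vectors are left over as there are rows still to fill.\<close>
  have "card (- I) = card (B \<union> C - e1 ` I)"
  proof -
    have "card (B \<union> C - e1 ` I) = CARD('k) - card I"
      using e1 card fin by (subst card_Diff_subset) (auto simp: card_image)
    then show ?thesis
      by (simp add: Compl_eq_Diff_UNIV card_Diff_subset)
  qed
  then obtain e2 where e2: "bij_betw e2 (- I) (B \<union> C - e1 ` I)"
    using finite_same_card_bij[of "- I" "B \<union> C - e1 ` I"] fin by auto
  define e where "e i = (if i \<in> I then e1 i else e2 i)" for i
  have e2': "inj_on e2 (- I)" "e2 ` (- I) = B \<union> C - e1 ` I"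
    using e2 by (simp_all add: bij_betw_def)
  have "inj e"
  proof (rule injI)
    fix i j
    assume eq: "e i = e j"
    consider "i \<in> I" "j \<in> I" | "i \<in> - I" "j \<in> - I" | "i \<in> I" "j \<in> - I" | "i \<in> - I" "j \<in> I"
      by blast
    then show "i = j"
    proof cases
      case 1
      then show ?thesis using eq e1(1) by (simp add: e_def inj_on_eq_iff)
    next
      case 2
      then show ?thesis using eq e2'(1) by (simp add: e_def inj_on_eq_iff)
    next
      case 3
      then have "e2 j \<in> B \<union> C - e1 ` I" using e2'(2) by blast
      then show ?thesis using 3 eq by (metis ComplD DiffD2 e_def image_eqI)
    next
      case 4
      then have "e2 i \<in> B \<union> C - e1 ` I" using e2'(2) by blast
      then show ?thesis using 4 eq by (metis ComplD DiffD2 e_def image_eqI)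
    qed
  qed
  moreover have eC: "e i \<in> C" if "i \<in> I" for i
    using that e1(2) by (auto simp: e_def)
  moreover have "e i \<in> B \<union> C" for i
    using eC e2'(2) by (cases "i \<in> I") (auto simp: e_def)
  ultimately have e: "inj e" "e i \<in> B \<union> C" "i \<in> I \<Longrightarrow> e i \<in> C" for i
    by blast+
  have orth: "orthogonal x y" if "x \<in> B \<union> C" "y \<in> B \<union> C" "x \<noteq> y" for x y
    using that B(2) C(2) BC unfolding pairwise_def by (metis UnE orthogonal_commute)
  define U where "U = (\<chi> i. e i)"
  have "row i U = e i" for i
    by (simp add: U_def row_def vec_eq_iff)
  moreover have "norm (e i) = 1" for i
    using e(2)[of i] B(3) C(3) by blast
  moreover have "orthogonal (e i) (e j)" if "i \<noteq> j" for i j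
    using that e(1) orth[OF e(2) e(2)] by (simp add: inj_eq)
  ultimately have "orthogonal_matrix U"
    by (simp add: orthogonal_matrix_orthonormal_rows)
  moreover have "(U *v (A *v x)) $ i = 0" if "i \<in> I" for i x
  proof -
    have "orthogonal (A *v x) (e i)"
      using e(3)[OF that] C(1) by (auto simp: W_def V_def)
    then show ?thesis
      by (simp add: U_def matrix_vector_mul_component orthogonal_def inner_commute)
  qed
  ultimately show ?thesis
    by (rule that)
qed

lemma det_nonzero_iff_inj:
  fixes A :: "real ^ 'n ^ 'n"
  shows "det A \<noteq> 0 \<longleftrightarrow> inj ((*v) A)"
  using det_nz_iff_inj[of "(*v) A"] by simp

lemma matrix_inj_iff:
  fixes A :: "real ^ 'n ^ 'm"
  shows "inj ((*v) A) \<longleftrightarrow> (\<forall>x. A *v x = 0 \<longrightarrow> x = 0)"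
  by (rule linear_injective_0) simp

subsection \<open>Normal forms\<close>

definition coord_squares :: "real ^ 'n \<Rightarrow> real ^ 'n" where
  "coord_squares x = (\<chi> j. (x $ j)\<^sup>2)"

definition cross_matrix :: "real ^ 'm ^ 'k \<Rightarrow> real ^ 'm ^ 'k \<Rightarrow> real ^ 'm ^ 'k" where
  "cross_matrix p A = (\<chi> i j. A $ i $ j * p $ i $ j)"

lemma dist_sq_map_eq:
  "dist_sq_map p A x =
     A *v coord_squares x - 2 *\<^sub>R (cross_matrix p A *v x) + (\<chi> i. \<Sum>j\<in>UNIV. A $ i $ j * (p $ i $ j)\<^sup>2)"
  by (simp add: dist_sq_map_def coord_squares_def cross_matrix_def vec_eq_iff matrix_vector_mult_def
      sum_subtractf[symmetric] sum.distrib[symmetric] sum_distrib_left power2_diff algebra_simps)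

lemma polynomial_coord_squares: "polynomial_function coord_squares"
  unfolding coord_squares_def
  by (intro polynomial_function_vec, simp, intro real_polynomial_function_power
      real_polynomial_function.intros(1) bounded_linear_vec_nth)

text \<open>In the coordinates given by \<open>U\<close>, the components at the positions
  \<open>\<iota> k\<close> lose their quadratic part. Up to a constant they are
  \<open>-2 E x\<close> with \<open>E\<close> invertible, hence a linear change of source
  coordinates.\<close>

lemma A_equivalent_std_inclusion:
  fixes A B :: "real ^ 'n::finite option ^ ('n + 'n) option"
    and U :: "real ^ ('n + 'n) option ^ ('n + 'n) option"
    and \<iota> :: "'n option \<Rightarrow> ('n + 'n) option"
  defines "\<iota> \<equiv> map_option Inl"
  assumes U: "orthogonal_matrix U" and UA: "\<And>k x. (U *v (A *v x)) $ \<iota> k = 0"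
    and nonsing: "det (\<chi> k. (U ** B) $ \<iota> k) \<noteq> 0"
    and f: "\<And>x. f x = A *v coord_squares x - 2 *\<^sub>R (B *v x) + c"
  shows "A_equivalent f std_inclusion"
proof -
  define E where "E = (\<chi> k. (U ** B) $ \<iota> k)"
  define D where "D x = - 2 *\<^sub>R (E *v x)" for x
  have E: "(E *v x) $ k = (U *v (B *v x)) $ \<iota> k" for x k
    by (simp add: E_def matrix_vector_mul_component matrix_vector_mul_assoc)
  have linD: "linear D"
    unfolding D_def by (intro linear_compose_scale_right matrix_vector_mul_linear)
  have "inj ((*v) E)"
    using nonsing by (simp add: E_def det_nonzero_iff_inj)
  then have injD: "inj D"
    by (simp add: D_def inj_def)
  obtain D' where D': "linear D'" "\<And>x. D' (D x) = x"
    using linear_injective_isomorphism[OF linD injD] by auto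
  define \<pi> where "\<pi> y = (\<chi> k. y $ \<iota> k)" for y :: "real ^ ('n + 'n) option"
  have \<pi>: "linear \<pi>"
    by (auto intro!: linearI simp: \<pi>_def vec_eq_iff)
  \<comment> \<open>All that separates the mapping from the inclusion, apart from the constant
    \<open>c\<close>; it vanishes at the positions \<open>\<iota> k\<close>.\<close>
  define r where "r x = U *v (A *v coord_squares x - 2 *\<^sub>R (B *v x)) - std_inclusion (D x)" for x
  have incl: "std_inclusion x $ \<iota> k = x $ k" for x :: "real ^ 'n option" and k
    by (cases k) (simp_all add: std_inclusion_def \<iota>_def)
  have \<pi>_incl: "\<pi> (std_inclusion x) = x" for x
    by (simp add: \<pi>_def incl vec_eq_iff)
  have "(U *v (2 *\<^sub>R (B *v x))) $ \<iota> k = 2 * (E *v x) $ k" for x k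
    by (simp add: E matrix_vector_mult_scaleR)
  then have \<pi>_r: "\<pi> (r x) = 0" for x
    by (simp add: \<pi>_def r_def D_def incl vec_eq_iff UA matrix_vector_mult_diff_distrib)
  \<comment> \<open>Reads only the components selected by \<open>\<pi>\<close>, which adding values
    of \<open>r\<close> leaves unchanged; hence both shear identities.\<close>
  define \<phi> where "\<phi> y = r (D' (\<pi> y))" for y
  have "polynomial_function r"
  proof -
    have "linear (std_inclusion :: real ^ 'n option \<Rightarrow> _)"
      by (auto intro!: linearI simp: std_inclusion_def vec_eq_iff split: option.splits sum.splits)
    then have "polynomial_function (\<lambda>x. std_inclusion (D x))"
      by (rule polynomial_function_linear_compose[OF _ polynomial_function_linear[OF linD]])
    then show ?thesis
      unfolding r_def
      by (intro polynomial_function_diff polynomial_function_matrix_vector polynomial_coord_squares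
          polynomial_function_cmul polynomial_function_id)
  qed
  moreover have "polynomial_function (D' \<circ> \<pi>)"
    by (intro polynomial_function_linear linear_compose \<pi> D')
  ultimately have "polynomial_function (r \<circ> (D' \<circ> \<pi>))"
    by (intro polynomial_function_compose[where g = r])
  then have pol: "polynomial_function \<phi>"
    unfolding \<phi>_def[abs_def] by (simp add: o_def)
  have "transpose U *v (U *v y) = y" for y
    using U by (simp add: matrix_vector_mul_assoc orthogonal_matrix)
  then have eq: "f x = transpose U *v (std_inclusion (D x + 0) + \<phi> (std_inclusion (D x + 0))) + c" for x
    by (simp add: f \<phi>_def \<pi>_incl D' r_def)
  have "U ** transpose U = mat 1"
    using U by (simp add: orthogonal_matrix_def)
  then have injU: "inj ((*v) (transpose U))"
    by (auto simp: matrix_left_invertible_injective[symmetric])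
  show ?thesis
  proof (rule A_equivalent_affine_shear[OF linD injD matrix_vector_mul_linear injU pol])
    show "f x = transpose U *v (std_inclusion (D x + 0) + \<phi> (std_inclusion (D x + 0))) + c" for x
      by (rule eq)
  qed (simp_all add: \<phi>_def linear_add[OF \<pi>] linear_diff[OF \<pi>] \<pi>_r)
qed

text \<open>
  Up to sign, the determinant of \<open>border j M\<close> is the maximal minor of \<open>M\<close> that omits column \<open>j\<close>.
\<close>

definition border :: "'n option \<Rightarrow> real ^ 'n option ^ 'n::finite \<Rightarrow> real ^ 'n option ^ 'n option" where
  "border j M = (\<chi> k. case k of None \<Rightarrow> axis j 1 | Some i \<Rightarrow> M $ i)"

lemma border_mult:
  "(border j M *v x) $ None = x $ j"
  "(border j M *v x) $ Some i = (M *v x) $ i"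
  by (simp_all add: border_def matrix_vector_mul_component inner_axis')

lemma border_eq_0_iff: "border j M *v x = 0 \<longleftrightarrow> x $ j = 0 \<and> M *v x = 0"
  by (auto simp: vec_eq_iff split_option_all border_mult)

text \<open>\<open>N\<close> consists of orthonormal linear forms that vanish on the range of
  \<open>A\<close>. The determinants say that a kernel vector of \<open>N ** B\<close> with one zero
  coordinate is zero.\<close>

lemma A_equivalent_whitney_umbrella:
  fixes A B :: "real ^ 'n::finite option ^ ('n + 'n) option"
    and N :: "real ^ ('n + 'n) option ^ 'n"
  assumes A: "inj ((*v) A)" and NA: "N ** A = 0" and NN: "N ** transpose N = mat 1"
    and nonsing: "\<And>j. det (border j (N ** B)) \<noteq> 0"
    and f: "\<And>x. f x = A *v coord_squares x - 2 *\<^sub>R (B *v x) + c"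
  shows "A_equivalent f whitney_umbrella"
proof -
  define M where "M = N ** B"
  define R where "R = transpose N"
  have border_inj: "x = 0" if "x $ j = 0" "M *v x = 0" for x j
    using nonsing[of j] that by (auto simp: det_nonzero_iff_inj matrix_inj_iff border_eq_0_iff M_def)
  have "surj ((*v) (border None M))"
    using nonsing[of None] unfolding det_nonzero_iff_inj M_def
    by (intro linear_inj_imp_surj) auto
  then obtain v where v: "border None M *v v = axis None 1"
    by (metis surjD)
  have v0: "v $ None = 1"
    using v border_mult(1)[of None M v] by (simp add: axis_def)
  have Mv: "M *v v = 0"
    using v border_mult(2)[of None M v] by (simp add: vec_eq_iff axis_def)
  have v_nz: "v $ j \<noteq> 0" for j
    using border_inj[of v j] Mv v0 by auto

  \<comment> \<open>Inverse bookkeeping for the target: \<open>u\<close> rebuilds the part along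
    \<open>A\<close> from \<open>s\<^sup>2\<close> and the \<open>s z\<^sub>j\<close>, and
    \<open>\<nu>\<close> rebuilds \<open>l\<close> from the \<open>z\<^sub>j\<close> up to a
    constant. The symbols \<open>s\<close>, \<open>z\<close>, \<open>l\<close> are introduced
    further below.\<close>
  define u where "u y = (\<chi> k. case k of None \<Rightarrow> y $ None
    | Some j \<Rightarrow> y $ Some (Inl j) + (v $ Some j)\<^sup>2 * y $ None)" for y :: "real ^ ('n + 'n) option"
  define \<nu> where "\<nu> y = (\<chi> k. case k of None \<Rightarrow> 0 | Some j \<Rightarrow> y $ Some (Inr j) / (2 * v $ Some j))"
    for y :: "real ^ ('n + 'n) option"
  define \<Lambda> where "\<Lambda> y = A *v u y + R *v (- 2 *\<^sub>R (M *v \<nu> y))" for y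
  have u: "linear u"
    by (auto intro!: linearI simp: u_def vec_eq_iff algebra_simps split: option.splits)
  have \<nu>: "linear \<nu>"
    by (auto intro!: linearI simp: \<nu>_def vec_eq_iff add_divide_distrib split: option.splits)
  have Au: "linear (\<lambda>y. A *v u y)"
    using linear_compose[OF u matrix_vector_mul_linear] by (simp add: o_def)
  have "linear (\<lambda>y. M *v \<nu> y)"
    using linear_compose[OF \<nu> matrix_vector_mul_linear] by (simp add: o_def)
  then have "linear (\<lambda>y. - 2 *\<^sub>R (M *v \<nu> y))"
    by (rule linear_compose_scale_right)
  from linear_compose[OF this matrix_vector_mul_linear]
  have "linear (\<lambda>y. R *v (- 2 *\<^sub>R (M *v \<nu> y)))"
    unfolding o_def .
  with Au have lin\<Lambda>: "linear \<Lambda>"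
    unfolding \<Lambda>_def[abs_def] by (rule linear_compose_add)
  have N\<Lambda>: "N *v (A *v a + R *v w) = w" for a w
    using NN by (simp add: matrix_vector_right_distrib matrix_vector_mul_assoc NA R_def[symmetric])
  \<comment> \<open>Applying \<open>N\<close> isolates \<open>M *v \<nu> y\<close>. As
    \<open>\<nu> y\<close> has zero coordinate at \<open>None\<close>, it vanishes; injectivity of
    \<open>A\<close> then handles \<open>u y\<close>.\<close>
  have inj\<Lambda>: "inj \<Lambda>"
    unfolding linear_injective_0[OF lin\<Lambda>]
  proof (intro allI impI)
    fix y
    assume y: "\<Lambda> y = 0"
    then have "M *v \<nu> y = 0"
      using N\<Lambda>[of "u y" "- 2 *\<^sub>R (M *v \<nu> y)"] by (simp add: \<Lambda>_def)
    moreover from this have "\<nu> y = 0"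
      by (intro border_inj[of _ None]) (simp_all add: \<nu>_def)
    ultimately have "A *v u y = 0"
      using y by (simp add: \<Lambda>_def)
    then have "u y = 0"
      using A by (simp add: matrix_inj_iff)
    with \<open>\<nu> y = 0\<close> show "y = 0"
      using v_nz by (auto simp: vec_eq_iff u_def \<nu>_def split_option_all split_sum_all)
  qed
  have "surj \<Lambda>"
    using lin\<Lambda> inj\<Lambda> by (rule linear_inj_imp_surj)
  \<comment> \<open>\<open>N\<close> annihilates \<open>A\<close> and has full rank, so its kernel is the range of \<open>A\<close>: thus \<open>B = A ** C + R ** M\<close>.\<close>
  have decomp: "\<exists>a. y = A *v a + R *v (N *v y)" for y
  proof -
    obtain z where "y = \<Lambda> z"
      using \<open>surj \<Lambda>\<close> by (metis surjD)
    then show ?thesis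
      using N\<Lambda>[of "u z"] by (auto simp: \<Lambda>_def)
  qed
  obtain A' where A': "A' ** A = mat 1"
    using A by (auto simp: matrix_left_invertible_injective[symmetric])
  \<comment> \<open>The left inverse reads off the coefficient along \<open>A\<close> linearly in
    \<open>x\<close>.\<close>
  define C where "C = A' ** (B - R ** M)"
  have C: "B *v x = A *v (C *v x) + R *v (M *v x)" for x
  proof -
    obtain a where a: "B *v x = A *v a + R *v (M *v x)"
      using decomp[of "B *v x"] by (auto simp: M_def matrix_vector_mul_assoc)
    have "C *v x = A' *v (B *v x - R *v (M *v x))"
      by (simp add: C_def matrix_vector_mul_assoc[symmetric] matrix_vector_mult_diff_rdistrib)
    also have "\<dots> = a"
      by (simp add: a matrix_vector_mul_assoc A')
    finally show ?thesis
      by (simp add: a)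
  qed

  \<comment> \<open>
    Put \<open>l = x - x\<^sub>0 v\<close>, \<open>s = x\<^sub>0 - c0\<close> and \<open>z\<^sub>j = 2 v\<^sub>j l\<^sub>j + d\<^sub>j\<close>. Then
    \<open>x\<^sub>0\<^sup>2 - 2 (C x)\<^sub>0 = s\<^sup>2 + \<dots>\<close> and \<open>x\<^sub>j\<^sup>2 - 2 (C x)\<^sub>j = v\<^sub>j\<^sup>2 s\<^sup>2 + s z\<^sub>j + \<dots>\<close>, where the dots are
    polynomials in \<open>z\<close> alone, and \<open>M x = M l\<close> is affine in \<open>z\<close>. The choice of \<open>d\<close> absorbs the terms linear in \<open>x\<^sub>0\<close>.
  \<close>
  define c0 where "c0 = (C *v v) $ None"
  define d where "d j = 2 * (v $ Some j)\<^sup>2 * c0 - 2 * (C *v v) $ Some j" for j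
  \<comment> \<open>\<open>D x + t\<close> has coordinates \<open>s\<close> and
    \<open>z\<^sub>j\<close>.\<close>
  define D where "D x = (\<chi> k. case k of None \<Rightarrow> x $ None
    | Some j \<Rightarrow> 2 * v $ Some j * (x $ Some j - v $ Some j * x $ None))" for x :: "real ^ 'n option"
  define t where "t = (\<chi> k. case k of None \<Rightarrow> - c0 | Some j \<Rightarrow> d j)"
  have linD: "linear D"
    by (auto intro!: linearI simp: D_def vec_eq_iff algebra_simps split: option.splits)
  have injD: "inj D"
    unfolding linear_injective_0[OF linD] using v_nz
    by (auto simp: D_def vec_eq_iff split_option_all)
  define \<mu> where "\<mu> y = (\<chi> k. case k of None \<Rightarrow> 0 | Some j \<Rightarrow> (y $ Some (Inr j) - d j) / (2 * v $ Some j))"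
    for y :: "real ^ ('n + 'n) option"
  \<comment> \<open>The constant by which the linear \<open>\<nu>\<close> exceeds the affine
    \<open>\<mu>\<close>; it ends up in the translation of the target.\<close>
  define e where "e = (\<chi> k. case k of None \<Rightarrow> 0 | Some j \<Rightarrow> d j / (2 * v $ Some j))"
  define \<phi>0 where "\<phi>0 y = - c0\<^sup>2 - 2 * (C *v \<mu> y) $ None" for y
  \<comment> \<open>The last summand at \<open>Inl j\<close> cancels the copy of
    \<open>\<phi>0 y\<close> that \<open>u\<close> adds from the component
    \<open>None\<close>.\<close>
  define \<phi> :: "real ^ ('n + 'n) option \<Rightarrow> real ^ ('n + 'n) option" where "\<phi> y = (\<chi> i. case i of
       None \<Rightarrow> \<phi>0 y
     | Some (Inl j) \<Rightarrow> (\<mu> y $ Some j)\<^sup>2 - 2 * (C *v \<mu> y) $ Some j + c0 * y $ Some (Inr j)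
         - (v $ Some j)\<^sup>2 * c0\<^sup>2 - (v $ Some j)\<^sup>2 * \<phi>0 y
     | Some (Inr j) \<Rightarrow> 0)" for y
  have \<phi>_Inr: "\<phi> y $ Some (Inr j) = 0" for y j
    by (simp add: \<phi>_def)
  \<comment> \<open>\<open>\<phi>\<close> depends only on the \<open>Inr\<close> components, where
    it is itself zero; this gives the shear identities.\<close>
  have \<phi>_cong: "\<phi> y = \<phi> z" if "\<And>j. y $ Some (Inr j) = z $ Some (Inr j)" for y z
  proof -
    have "\<mu> y = \<mu> z"
      using that by (auto simp: \<mu>_def vec_eq_iff split: option.splits)
    then show ?thesis
      unfolding \<phi>_def \<phi>0_def by (simp add: that)
  qed
  have pol: "polynomial_function \<phi>"
  proof (rule polynomial_function_vec)
    have nth: "real_polynomial_function (\<lambda>y :: real ^ ('n + 'n) option. y $ i)" for i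
      by (intro real_polynomial_function.intros(1) bounded_linear_vec_nth)
    have \<mu>_nth: "real_polynomial_function (\<lambda>y. \<mu> y $ k)" for k
      by (cases k) (simp_all add: \<mu>_def real_polynomial_function_divide real_polynomial_function_diff
          real_polynomial_function.intros(2) nth)
    have "polynomial_function (\<lambda>y. C *v \<mu> y)"
      by (intro polynomial_function_matrix_vector polynomial_function_vec \<mu>_nth)
    then have C\<mu>: "real_polynomial_function (\<lambda>y. (C *v \<mu> y) $ k)" for k
      by (simp add: real_polynomial_function_eq polynomial_function_nth)
    have \<phi>0: "real_polynomial_function \<phi>0"
      unfolding \<phi>0_def
      by (intro real_polynomial_function_diff real_polynomial_function.intros(2,4) C\<mu>)
    show "real_polynomial_function (\<lambda>y. \<phi> y $ i)" for i
    proof (cases i)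
      case None
      then show ?thesis
        by (simp add: \<phi>_def \<phi>0)
    next
      case (Some k)
      then show ?thesis
        by (cases k) (auto simp: \<phi>_def intro!: real_polynomial_function_diff real_polynomial_function.intros(2-4)
            real_polynomial_function_power \<phi>0 C\<mu> \<mu>_nth nth)
    qed
  qed

  have eq: "f x = \<Lambda> (whitney_umbrella (D x + t) + \<phi> (whitney_umbrella (D x + t))) + (c + R *v (2 *\<^sub>R (M *v e)))" for x
  proof -
    define y where "y = whitney_umbrella (D x + t)"
    define l where "l = x - x $ None *\<^sub>R v"
    have Inr: "y $ Some (Inr j) = 2 * v $ Some j * l $ Some j + d j" for j
      by (simp add: y_def whitney_umbrella_def D_def t_def l_def algebra_simps)
    have \<mu>: "\<mu> y = l"
      using v_nz by (auto simp: \<mu>_def Inr vec_eq_iff split_option_all l_def v0)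
    have l0: "l $ None = 0"
      by (simp add: l_def v0)
    have x: "x = x $ None *\<^sub>R v + l"
      by (simp add: l_def)
    have Cx: "C *v x = x $ None *\<^sub>R (C *v v) + C *v l"
      by (subst x) (simp add: matrix_vector_right_distrib matrix_vector_mult_scaleR)
    have Mx: "M *v x = M *v l"
      by (subst x) (simp add: matrix_vector_right_distrib matrix_vector_mult_scaleR Mv)
    have "\<nu> (y + \<phi> y) = l + e"
      using v_nz by (auto simp: \<nu>_def e_def Inr \<phi>_Inr vec_eq_iff split_option_all l0 field_simps)
    then have 1: "- 2 *\<^sub>R (M *v x) = - 2 *\<^sub>R (M *v \<nu> (y + \<phi> y)) + 2 *\<^sub>R (M *v e)"
      by (simp add: Mx matrix_vector_right_distrib scaleR_add_right)
    have 2: "u (y + \<phi> y) = coord_squares x - 2 *\<^sub>R (C *v x)"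
    proof -
      have None: "y $ None = (x $ None - c0)\<^sup>2"
        by (simp add: y_def whitney_umbrella_def D_def t_def)
      have Inl: "y $ Some (Inl j) = (x $ None - c0) * (2 * v $ Some j * l $ Some j + d j)" for j
        using Inr[of j] by (simp add: y_def whitney_umbrella_def D_def t_def)
      have xj: "x $ Some j = x $ None * v $ Some j + l $ Some j" for j
        by (simp add: l_def)
      have "u (y + \<phi> y) $ None = (coord_squares x - 2 *\<^sub>R (C *v x)) $ None"
        by (simp add: u_def None \<phi>_def \<phi>0_def \<mu> coord_squares_def Cx c0_def[symmetric] power2_eq_square algebra_simps)
      moreover have "u (y + \<phi> y) $ Some j = (coord_squares x - 2 *\<^sub>R (C *v x)) $ Some j" for j
        by (simp add: u_def None Inl Inr \<phi>_def \<phi>0_def \<mu> coord_squares_def Cx xj d_def power2_eq_square algebra_simps)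
      ultimately show ?thesis
        by (simp add: vec_eq_iff split_option_all)
    qed
    have "f x = A *v (coord_squares x - 2 *\<^sub>R (C *v x)) + R *v (- 2 *\<^sub>R (M *v x)) + c"
      using matrix_vector_mult_scaleR[of R "- 2" "M *v x"]
      by (simp add: f C matrix_vector_mult_diff_distrib matrix_vector_mult_scaleR scaleR_add_right)
    also have "\<dots> = \<Lambda> (y + \<phi> y) + (c + R *v (2 *\<^sub>R (M *v e)))"
      by (simp only: 1 2 \<Lambda>_def matrix_vector_right_distrib ac_simps)
    finally show ?thesis
      by (simp add: y_def)
  qed
  show ?thesis
  proof (rule A_equivalent_affine_shear[OF linD injD lin\<Lambda> inj\<Lambda> pol])
    show "f x = \<Lambda> (whitney_umbrella (D x + t) + \<phi> (whitney_umbrella (D x + t))) +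
        (c + R *v (2 *\<^sub>R (M *v e)))" for x
      by (rule eq)
  qed (rule \<phi>_cong, simp add: \<phi>_Inr)+
qed

subsection \<open>Generic points\<close>

lemma real_polynomial_function_matrix_mult_cross_matrix:
  fixes A :: "real ^ 'm ^ 'k" and L :: "real ^ 'k ^ 'i"
  shows "real_polynomial_function (\<lambda>p. (L ** cross_matrix p A) $ i $ j)"
proof -
  have "bounded_linear (\<lambda>p :: real ^ 'm ^ 'k. p $ a $ b)" for a b
    by (rule bounded_linear_compose[OF bounded_linear_vec_nth bounded_linear_vec_nth])
  then show ?thesis
    unfolding matrix_matrix_mult_def cross_matrix_def
    by (simp, intro real_polynomial_function_sum real_polynomial_function.intros) auto
qed

lemma cross_matrix_surj:
  assumes "\<And>i j. A $ i $ j \<noteq> 0"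
  shows "cross_matrix (\<chi> i j. B $ i $ j / A $ i $ j) A = B"
  using assms by (simp add: cross_matrix_def vec_eq_iff)

lemma generic_std_inclusion:
  fixes A :: "real ^ 'n::finite option ^ ('n + 'n) option"
  assumes nz: "\<And>i j. A $ i $ j \<noteq> 0" and rank: "rank A < CARD('n) + 1"
  shows "\<exists>S :: (real ^ 'n option ^ ('n + 'n) option) set.
           closed S \<and> S \<in> null_sets lebesgue \<and>
           (\<forall>p. p \<notin> S \<longrightarrow> A_equivalent (dist_sq_map p A) std_inclusion)"
proof -
  define \<iota> :: "'n option \<Rightarrow> ('n + 'n) option" where "\<iota> = map_option Inl"
  have inj: "inj \<iota>"
    unfolding \<iota>_def by (intro option.inj_map) simp
  then have "card (range \<iota>) = CARD('n) + 1"
    by (simp add: card_image)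
  then have "rank A + card (range \<iota>) \<le> CARD(('n + 'n) option)"
    using rank by simp
  then obtain U where U: "orthogonal_matrix U" "\<And>k x. (U *v (A *v x)) $ \<iota> k = 0"
    by (rule exists_orthogonal_annihilator) blast
  define F where "F p = (\<chi> k. (U ** cross_matrix p A) $ \<iota> k)" for p
  \<comment> \<open>Column \<open>j\<close> is row \<open>\<iota> j\<close> of \<open>U\<close>, so
    orthonormality turns the selected rows of \<open>U ** E\<close> into the identity.\<close>
  define E where "E = (\<chi> i j. U $ \<iota> j $ i)"
  define q where "q = (\<chi> i j. E $ i $ j / A $ i $ j)"
  have q: "cross_matrix q A = E"
    unfolding q_def using nz by (rule cross_matrix_surj)
  have UU: "(U ** transpose U) $ a $ b = (if a = b then 1 else 0)" for a b
    using U(1) by (simp add: orthogonal_matrix_def mat_def)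
  from UU inj have "F q = mat 1"
    by (simp add: F_def q E_def vec_eq_iff matrix_matrix_mult_def transpose_def mat_def inj_eq)
  then have "det (F q) \<noteq> 0"
    by simp
  moreover have "real_polynomial_function (\<lambda>p. F p $ k $ j)" for k j
    by (simp add: F_def real_polynomial_function_matrix_mult_cross_matrix)
  ultimately have S: "closed {p. det (F p) = 0}" "{p. det (F p) = 0} \<in> null_sets lebesgue"
    by (auto intro: closed_null_zeros_det)
  have "A_equivalent (dist_sq_map p A) std_inclusion" if "p \<notin> {p. det (F p) = 0}" for p
    using that U
    by (intro A_equivalent_std_inclusion[of U A "cross_matrix p A"])
      (auto simp: dist_sq_map_eq F_def \<iota>_def)
  with S show ?thesis
    by blast
qed

lemma generic_whitney_umbrella:
  fixes A :: "real ^ 'n::finite option ^ ('n + 'n) option"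
  assumes nz: "\<And>i j. A $ i $ j \<noteq> 0" and rank: "rank A = CARD('n) + 1"
  shows "\<exists>S :: (real ^ 'n option ^ ('n + 'n) option) set.
           closed S \<and> S \<in> null_sets lebesgue \<and>
           (\<forall>p. p \<notin> S \<longrightarrow> A_equivalent (dist_sq_map p A) whitney_umbrella)"
proof -
  define \<iota> :: "'n \<Rightarrow> ('n + 'n) option" where "\<iota> j = Some (Inr j)" for j
  have inj: "inj \<iota>"
    by (simp add: \<iota>_def inj_def)
  then have "card (range \<iota>) = CARD('n)"
    by (simp add: card_image)
  then have "rank A + card (range \<iota>) \<le> CARD(('n + 'n) option)"
    using rank by simp
  then obtain U where U: "orthogonal_matrix U" "\<And>k x. (U *v (A *v x)) $ \<iota> k = 0"
    by (rule exists_orthogonal_annihilator) blast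
  define N where "N = (\<chi> k. U $ \<iota> k)"
  have UU: "(U ** transpose U) $ a $ b = (if a = b then 1 else 0)" for a b
    using U(1) by (simp add: orthogonal_matrix_def mat_def)
  have NN: "N ** transpose N = mat 1"
    using UU inj by (simp add: N_def vec_eq_iff matrix_matrix_mult_def transpose_def mat_def inj_eq)
  have "N *v (A *v x) = 0" for x
    using U(2) by (simp add: N_def vec_eq_iff matrix_vector_mul_component)
  then have NA: "N ** A = 0"
    by (simp add: matrix_eq matrix_vector_mul_assoc)
  have A: "inj ((*v) A)"
    using rank by (simp add: full_rank_injective[symmetric])
  define F where "F j p = border j (N ** cross_matrix p A)" for j p
  have S: "closed {p. det (F j p) = 0}" "{p. det (F j p) = 0} \<in> null_sets lebesgue" for j
  proof -
    \<comment> \<open>The transposition of \<open>None\<close> and \<open>j\<close>. The rows of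
      \<open>E\<close> are then the unit vectors for all indices except \<open>j\<close>, and
      \<open>border j E\<close> is a permutation matrix.\<close>
    define \<sigma> where "\<sigma> k = (if k = None then j else if k = j then None else k)" for k
    define E where "E = (\<chi> i. axis (\<sigma> (Some i)) (1::real))"
    \<comment> \<open>\<open>transpose N\<close> is a right inverse of \<open>N\<close>, so this
      \<open>q\<close> realises \<open>E\<close> as \<open>N ** cross_matrix q A\<close>.\<close>
    define q where "q = (\<chi> i j. (transpose N ** E) $ i $ j / A $ i $ j)"
    have "N ** cross_matrix q A = E"
      unfolding q_def cross_matrix_surj[OF nz] by (simp add: matrix_mul_assoc NN)
    moreover have "x = 0" if "border j E *v x = 0" for x
    proof -
      have j: "x $ j = 0" and "\<And>i. (E *v x) $ i = 0"
        using that by (auto simp: border_eq_0_iff)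
      then have "x $ \<sigma> (Some i) = 0" for i
        by (simp add: E_def matrix_vector_mul_component inner_axis')
      then have "x $ \<sigma> k = 0" for k
        using j by (cases k) (simp_all add: \<sigma>_def)
      moreover have "\<sigma> (\<sigma> k) = k" for k
        unfolding \<sigma>_def by auto
      ultimately show ?thesis
        by (metis vec_eq_iff zero_index)
    qed
    ultimately have "det (F j q) \<noteq> 0"
      by (simp add: F_def det_nonzero_iff_inj matrix_inj_iff)
    moreover have "real_polynomial_function (\<lambda>p. F j p $ a $ b)" for a b
      by (cases a) (simp_all add: F_def border_def real_polynomial_function_matrix_mult_cross_matrix
          real_polynomial_function.intros(2))
    ultimately show "closed {p. det (F j p) = 0}" "{p. det (F j p) = 0} \<in> null_sets lebesgue"
      using closed_null_zeros_det[of "F j" q] by simp_all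
  qed
  define S where "S = (\<Union>j. {p. det (F j p) = 0})"
  have "closed S" "S \<in> null_sets lebesgue"
    unfolding S_def using S by (auto intro!: closed_UN null_sets_UN' countable_finite)
  moreover have "A_equivalent (dist_sq_map p A) whitney_umbrella" if "p \<notin> S" for p
    using that
    by (intro A_equivalent_whitney_umbrella[OF A NA NN, of "cross_matrix p A"])
      (auto simp: dist_sq_map_eq F_def S_def)
  ultimately show ?thesis
    by blast
qed

theorem theorem1:
  fixes A :: "real ^ 'n::finite option ^ ('n + 'n) option"
  assumes "\<And>i j. A $ i $ j \<noteq> 0"
  shows "(rank A = CARD('n) + 1 \<longrightarrow>
           (\<exists>S :: (real ^ 'n option ^ ('n + 'n) option) set.
              closed S \<and> S \<in> null_sets lebesgue \<and>
              (\<forall>p. p \<notin> S \<longrightarrow> A_equivalent (dist_sq_map p A) whitney_umbrella)))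
       \<and> (rank A < CARD('n) + 1 \<longrightarrow>
           (\<exists>S :: (real ^ 'n option ^ ('n + 'n) option) set.
              closed S \<and> S \<in> null_sets lebesgue \<and>
              (\<forall>p. p \<notin> S \<longrightarrow> A_equivalent (dist_sq_map p A) std_inclusion)))"
  using generic_whitney_umbrella[OF assms] generic_std_inclusion[OF assms] by blast

end
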